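(* Let $\mathcal{A}$ be a $\mathbf{tDL}$-algebra, $X\subseteq A$ non-empty, and for $p\in\omega$ let $D_p(X)=\{y\in A:\text{there are } n\in\mathbb{N} \text{ and } x_1,\dots,x_n\in X \text{ with } d^p(\bigwedge_{i=1}^n x_i)\le y\}$. Let $\mathcal{D}=\{D_p(X)\}_{p\in\omega}$. Then: (1) $\mathcal{D}$ is an increasing chain of lattice filters of $A$; (2) $\bigcup\mathcal{D}$ is a tense filter of $\mathcal{A}$; (3) $\bigcup\mathcal{D}$ equals the tense filter generated by $X$ (the least tense filter containing $X$).
   Context: A $\mathbf{tDL}$-algebra is a bounded distributive lattice $\langle A,\wedge,\vee,0,1\rangle$ with unary operators $\mathbf{G},\mathbf{H},\mathbf{F},\mathbf{P}$ such that for all $x,y$: $\mathbf{G}1=\mathbf{H}1=1$; $\mathbf{G},\mathbf{H}$ preserve $\wedge$; $x\le\mathbf{G}\mathbf{P}x$, $x\le\mathbf{H}\mathbf{F}x$; $\mathbf{G}(x\vee y)\le\mathbf{G}x\vee\mathbf{F}y$, $\mathbf{H}(x\vee y)\le\mathbf{H}x\vee\mathbf{P}y$; $\mathbf{F}0=\mathbf{P}0=0$; $\mathbf{F},\mathbf{P}$ preserve $\vee$; $\mathbf{P}\mathbf{G}x\le x$, $\mathbf{F}\mathbf{H}x\le x$; $\mathbf{G}x\wedge\mathbf{F}y\le\mathbf{F}(x\wedge y)$, $\mathbf{H}x\wedge\mathbf{P}y\le\mathbf{P}(x\wedge y)$. $dx=\mathbf{G}x\wedge x\wedge\mathbf{H}x$,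 $d^0x=x$, $d^{n+1}x=d(d^nx)$. A tense filter is a lattice filter $S$ with $\mathbf{G}x,\mathbf{H}x\in S$ for all $x\in S$. *)

theory Defs
  imports Main
begin

unbundle lattice_syntax

text \<open>
  The underlying bounded distributive lattice is given by the type classes of \<open>'a\<close>;
  its carrier is the whole type. The case \<open>\<bottom> = \<top>\<close> is not excluded.
\<close>

locale tDL_algebra =
  fixes G H F P :: "'a::{distrib_lattice, bounded_lattice} \<Rightarrow> 'a"
  assumes G_top: "G \<top> = \<top>" and H_top: "H \<top> = \<top>"
    and G_inf: "G (x \<sqinter> y) = G x \<sqinter> G y" and H_inf: "H (x \<sqinter> y) = H x \<sqinter> H y"
    and le_GP: "x \<le> G (P x)" and le_HF: "x \<le> H (F x)"
    and G_sup_le: "G (x \<squnion> y) \<le> G x \<squnion> F y" and H_sup_le: "H (x \<squnion> y) \<le> H x \<squnion> P y"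
    and F_bot: "F \<bottom> = \<bottom>" and P_bot: "P \<bottom> = \<bottom>"
    and F_sup: "F (x \<squnion> y) = F x \<squnion> F y" and P_sup: "P (x \<squnion> y) = P x \<squnion> P y"
    and PG_le: "P (G x) \<le> x" and FH_le: "F (H x) \<le> x"
    and G_inf_F_le: "G x \<sqinter> F y \<le> F (x \<sqinter> y)" and H_inf_P_le: "H x \<sqinter> P y \<le> P (x \<sqinter> y)"

definition tense_d :: "('a::lattice \<Rightarrow> 'a) \<Rightarrow> ('a \<Rightarrow> 'a) \<Rightarrow> 'a \<Rightarrow> 'a" where
  "tense_d G H x = G x \<sqinter> x \<sqinter> H x"

text \<open>Filters are non-empty, but the improper filter \<open>UNIV\<close> counts as a filter.\<close>

definition lattice_filter :: "'a::lattice set \<Rightarrow> bool" where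
  "lattice_filter S \<longleftrightarrow>
     S \<noteq> {} \<and> (\<forall>x\<in>S. \<forall>y\<in>S. x \<sqinter> y \<in> S) \<and> (\<forall>x\<in>S. \<forall>y. x \<le> y \<longrightarrow> y \<in> S)"

definition tense_filter :: "('a::lattice \<Rightarrow> 'a) \<Rightarrow> ('a \<Rightarrow> 'a) \<Rightarrow> 'a set \<Rightarrow> bool" where
  "tense_filter G H S \<longleftrightarrow> lattice_filter S \<and> (\<forall>x\<in>S. G x \<in> S \<and> H x \<in> S)"

text \<open>\<open>T\<close> is the least tense filter containing \<open>X\<close>; by antisymmetry there is at most one such \<open>T\<close>.\<close>

definition is_tense_filter_generated_by ::
    "('a::lattice \<Rightarrow> 'a) \<Rightarrow> ('a \<Rightarrow> 'a) \<Rightarrow> 'a set \<Rightarrow> 'a set \<Rightarrow> bool" where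
  "is_tense_filter_generated_by G H X T \<longleftrightarrow>
     tense_filter G H T \<and> X \<subseteq> T \<and> (\<forall>S. tense_filter G H S \<and> X \<subseteq> S \<longrightarrow> T \<subseteq> S)"

text \<open>
  \<open>\<Sqinter>\<^sub>f\<^sub>i\<^sub>n\<close> is the meet of a finite non-empty set, hence \<open>n \<ge> 1\<close>. For non-empty \<open>X\<close>, admitting
  the empty meet \<open>\<top>\<close> would not change the set when \<open>G \<top> = H \<top> = \<top>\<close>.
\<close>

definition D_set :: "('a::lattice \<Rightarrow> 'a) \<Rightarrow> ('a \<Rightarrow> 'a) \<Rightarrow> 'a set \<Rightarrow> nat \<Rightarrow> 'a set" where
  "D_set G H X p =
     {y. \<exists>n\<ge>1. \<exists>x :: nat \<Rightarrow> 'a. (\<forall>i\<in>{1..n}. x i \<in> X) \<and>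
           (tense_d G H ^^ p) (\<Sqinter>\<^sub>f\<^sub>i\<^sub>n (x ` {1..n})) \<le> y}"

end

theory Submission
  imports Defs
begin

text \<open>
  The operator \<open>d\<close> preserves binary meets and satisfies \<open>d x \<le> x\<close>, hence so do its iterates;
  this gives the increasing chain of filters. The union is closed under \<open>G\<close> and \<open>H\<close> because
  \<open>d (d\<^sup>p m)\<close> lies below both \<open>G (d\<^sup>p m)\<close> and \<open>H (d\<^sup>p m)\<close>, and it is least because every tense filter
  is closed under \<open>d\<close> and finite meets.
\<close>

text \<open>Trades indexed families for finite non-empty sets of generators. Two witnesses can then
  be merged by a union, with no concatenation of index ranges.\<close>

lemma mem_D_set_iff:
  "y \<in> D_set G H X p \<longleftrightarrow>
     (\<exists>A. finite A \<and> A \<noteq> {} \<and> A \<subseteq> X \<and> (tense_d G H ^^ p) (\<Sqinter>\<^sub>f\<^sub>i\<^sub>n A) \<le> y)"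
proof
  assume "y \<in> D_set G H X p"
  then obtain n and x :: "nat \<Rightarrow> 'a" where "n \<ge> 1" "\<forall>i\<in>{1..n}. x i \<in> X"
    "(tense_d G H ^^ p) (\<Sqinter>\<^sub>f\<^sub>i\<^sub>n (x ` {1..n})) \<le> y"
    unfolding D_set_def by blast
  then show "\<exists>A. finite A \<and> A \<noteq> {} \<and> A \<subseteq> X \<and> (tense_d G H ^^ p) (\<Sqinter>\<^sub>f\<^sub>i\<^sub>n A) \<le> y"
    by (intro exI[of _ "x ` {1..n}"]) auto
next
  assume "\<exists>A. finite A \<and> A \<noteq> {} \<and> A \<subseteq> X \<and> (tense_d G H ^^ p) (\<Sqinter>\<^sub>f\<^sub>i\<^sub>n A) \<le> y"
  then obtain A where A: "finite A" "A \<noteq> {}" "A \<subseteq> X" "(tense_d G H ^^ p) (\<Sqinter>\<^sub>f\<^sub>i\<^sub>n A) \<le> y"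
    by blast
  \<comment> \<open>The enumeration of \<open>A\<close> starts at index 1, to match the range
    \<open>{1..n}\<close> in \<open>D_set\<close>.\<close>
  obtain x where "bij_betw x {1..card A} A"
    using ex_bij_betw_nat_finite_1[OF A(1)] by blast
  then have x: "x ` {1..card A} = A"
    by (simp add: bij_betw_def)
  have "card A \<ge> 1"
    using A(1,2) by (simp add: Suc_le_eq card_gt_0_iff)
  moreover have "\<forall>i\<in>{1..card A}. x i \<in> X"
    using x A(3) by blast
  ultimately show "y \<in> D_set G H X p"
    unfolding D_set_def mem_Collect_eq using x A(4)
    by (intro exI[of _ "card A"] exI[of _ x] conjI) simp_all
qed

context tDL_algebra
begin

lemma tense_d_le: "tense_d G H x \<le> x"
  by (simp add: tense_d_def le_infI1)

lemma tense_d_inf: "tense_d G H (x \<sqinter> y) = tense_d G H x \<sqinter> tense_d G H y"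
  by (simp add: tense_d_def G_inf H_inf ac_simps)

lemma funpow_tense_d_inf:
  "(tense_d G H ^^ p) (x \<sqinter> y) = (tense_d G H ^^ p) x \<sqinter> (tense_d G H ^^ p) y"
  by (induction p) (simp_all add: tense_d_inf)

lemma mono_G: "x \<le> y \<Longrightarrow> G x \<le> G y"
  by (metis G_inf le_iff_inf)

lemma mono_H: "x \<le> y \<Longrightarrow> H x \<le> H y"
  by (metis H_inf le_iff_inf)

lemma lattice_filter_D_set:
  assumes "X \<noteq> {}"
  shows "lattice_filter (D_set G H X p)"
proof -
  \<comment> \<open>Non-emptiness of the filter is where \<open>X \<noteq> {}\<close> enters: the
    witness set must itself be non-empty, and a singleton suffices.\<close>
  obtain a where "a \<in> X"
    using assms by blast
  then have "(tense_d G H ^^ p) (\<Sqinter>\<^sub>f\<^sub>i\<^sub>n {a}) \<in> D_set G H X p"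
    unfolding mem_D_set_iff by (intro exI[of _ "{a}"]) simp
  moreover have "x \<sqinter> y \<in> D_set G H X p" if x: "x \<in> D_set G H X p" and y: "y \<in> D_set G H X p" for x y
  proof -
    obtain A where A: "finite A" "A \<noteq> {}" "A \<subseteq> X" "(tense_d G H ^^ p) (\<Sqinter>\<^sub>f\<^sub>i\<^sub>n A) \<le> x"
      using x unfolding mem_D_set_iff by blast
    obtain B where B: "finite B" "B \<noteq> {}" "B \<subseteq> X" "(tense_d G H ^^ p) (\<Sqinter>\<^sub>f\<^sub>i\<^sub>n B) \<le> y"
      using y unfolding mem_D_set_iff by blast
    \<comment> \<open>The meet over \<open>A \<union> B\<close> splits into the two meets, and the
      iterate of \<open>d\<close> distributes over this binary meet.\<close>
    have "(tense_d G H ^^ p) (\<Sqinter>\<^sub>f\<^sub>i\<^sub>n (A \<union> B)) \<le> x \<sqinter> y"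
      using inf_mono[OF A(4) B(4)] A(1,2) B(1,2) by (simp add: Inf_fin.union funpow_tense_d_inf)
    with A B show ?thesis
      unfolding mem_D_set_iff by (intro exI[of _ "A \<union> B"]) simp
  qed
  moreover have "y \<in> D_set G H X p" if "x \<in> D_set G H X p" "x \<le> y" for x y
    using that unfolding mem_D_set_iff by (meson order_trans)
  ultimately show ?thesis
    unfolding lattice_filter_def by blast
qed

text \<open>The same set of generators witnesses membership at the next stage, since one more
  application of \<open>d\<close> only goes down.\<close>

lemma mono_D_set: "mono (D_set G H X)"
proof (rule mono_iff_le_Suc[THEN iffD2], intro allI subsetI)
  fix p y
  assume "y \<in> D_set G H X p"
  moreover have "(tense_d G H ^^ Suc p) m \<le> (tense_d G H ^^ p) m" for m
    by (simp add: tense_d_le)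
  ultimately show "y \<in> D_set G H X (Suc p)"
    unfolding mem_D_set_iff using order_trans by blast
qed

text \<open>The witness set is kept and only the exponent grows by one, a shift that the union over
  all stages absorbs.\<close>

lemma G_H_mem_D_set_Suc:
  assumes "x \<in> D_set G H X p"
  shows "G x \<in> D_set G H X (Suc p)" "H x \<in> D_set G H X (Suc p)"
proof -
  obtain A where A: "finite A" "A \<noteq> {}" "A \<subseteq> X" "(tense_d G H ^^ p) (\<Sqinter>\<^sub>f\<^sub>i\<^sub>n A) \<le> x"
    using assms unfolding mem_D_set_iff by blast
  have "(tense_d G H ^^ Suc p) (\<Sqinter>\<^sub>f\<^sub>i\<^sub>n A) \<le> G x"
    \<comment> \<open>Reassociating makes the \<open>G\<close>-conjunct of \<open>d\<close> the
      whole left operand, so a single \<open>le_infI1\<close> reaches it.\<close>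
    using mono_G[OF A(4)] by (simp add: tense_d_def inf_assoc le_infI1)
  then show "G x \<in> D_set G H X (Suc p)"
    using A(1-3) unfolding mem_D_set_iff by blast
  have "(tense_d G H ^^ Suc p) (\<Sqinter>\<^sub>f\<^sub>i\<^sub>n A) \<le> H x"
    using mono_H[OF A(4)] by (simp add: tense_d_def le_infI2)
  then show "H x \<in> D_set G H X (Suc p)"
    using A(1-3) unfolding mem_D_set_iff by blast
qed

lemma tense_filter_Union_D_set:
  assumes "X \<noteq> {}"
  shows "tense_filter G H (\<Union> (range (D_set G H X)))" (is "tense_filter G H ?U")
proof -
  have filt: "lattice_filter (D_set G H X p)" for p
    using assms by (rule lattice_filter_D_set)
  have mem: "z \<in> ?U" if "z \<in> D_set G H X p" for z p
    using that by blast
  have "x \<sqinter> y \<in> ?U" if xy: "x \<in> ?U" "y \<in> ?U" for x y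
  proof -
    obtain p q where "x \<in> D_set G H X p" "y \<in> D_set G H X q"
      using xy by blast
    \<comment> \<open>Meets in the union rely on the chain property: both elements are moved up to a
      common stage, which is a filter.\<close>
    then have "x \<in> D_set G H X (max p q)" "y \<in> D_set G H X (max p q)"
      using monoD[OF mono_D_set max.cobounded1] monoD[OF mono_D_set max.cobounded2]
      by blast+
    then show ?thesis
      using filt[of "max p q"] mem[of _ "max p q"] unfolding lattice_filter_def by simp
  qed
  moreover have "y \<in> ?U" if x: "x \<in> ?U" and "x \<le> y" for x y
  proof -
    obtain p where "x \<in> D_set G H X p"
      using x by blast
    then show ?thesis
      using \<open>x \<le> y\<close> filt[of p] mem[of y p] unfolding lattice_filter_def by simp
  qed
  moreover have "?U \<noteq> {}"
    using filt unfolding lattice_filter_def by simp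
  ultimately have "lattice_filter ?U"
    unfolding lattice_filter_def by simp
  moreover have "G x \<in> ?U \<and> H x \<in> ?U" if x: "x \<in> ?U" for x
  proof -
    obtain p where "x \<in> D_set G H X p"
      using x by blast
    then show ?thesis
      by (intro conjI mem[OF G_H_mem_D_set_Suc(1)] mem[OF G_H_mem_D_set_Suc(2)])
  qed
  ultimately show ?thesis
    unfolding tense_filter_def by simp
qed

end

lemma subset_Union_D_set: "X \<subseteq> \<Union> (range (D_set G H X))"
proof
  fix x
  assume "x \<in> X"
  \<comment> \<open>At stage 0 the iterate is the identity, so the singleton meet is
    \<open>x\<close> itself.\<close>
  then have "x \<in> D_set G H X 0"
    unfolding mem_D_set_iff by (intro exI[of _ "{x}"]) simp
  then show "x \<in> \<Union> (range (D_set G H X))"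
    by blast
qed

lemma lattice_filter_Inf_fin:
  assumes "lattice_filter S" "finite A" "A \<noteq> {}" "A \<subseteq> S"
  shows "\<Sqinter>\<^sub>f\<^sub>i\<^sub>n A \<in> S"
  using assms(2-4)
  by (induction rule: finite_ne_induct) (use assms(1) in \<open>auto simp: lattice_filter_def\<close>)

lemma tense_filter_funpow_tense_d:
  assumes "tense_filter G H S" "x \<in> S"
  shows "(tense_d G H ^^ p) x \<in> S"
  using assms by (induction p) (auto simp: tense_d_def tense_filter_def lattice_filter_def)

text \<open>The leastness half, one stage at a time: \<open>S\<close> contains the finite meet of
  generators, then its iterate under \<open>d\<close>, then everything above.\<close>

lemma D_set_subset_tense_filter:
  assumes S: "tense_filter G H S" and "X \<subseteq> S"
  shows "D_set G H X p \<subseteq> S"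
proof
  fix y
  assume "y \<in> D_set G H X p"
  then obtain A where A: "finite A" "A \<noteq> {}" "A \<subseteq> X" "(tense_d G H ^^ p) (\<Sqinter>\<^sub>f\<^sub>i\<^sub>n A) \<le> y"
    unfolding mem_D_set_iff by blast
  have filt: "lattice_filter S"
    using S by (simp add: tense_filter_def)
  have "\<Sqinter>\<^sub>f\<^sub>i\<^sub>n A \<in> S"
    using lattice_filter_Inf_fin[OF filt A(1,2)] A(3) assms(2) by blast
  then have "(tense_d G H ^^ p) (\<Sqinter>\<^sub>f\<^sub>i\<^sub>n A) \<in> S"
    by (rule tense_filter_funpow_tense_d[OF S])
  with A(4) filt show "y \<in> S"
    unfolding lattice_filter_def by blast
qed

theorem theorem2p29:
  fixes G H F P :: "'a::{distrib_lattice, bounded_lattice} \<Rightarrow> 'a"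
    and X :: "'a set"
  assumes "tDL_algebra G H F P"
    and "X \<noteq> {}"
  shows "((\<forall>p. lattice_filter (D_set G H X p)) \<and> mono (D_set G H X)) \<and>
    tense_filter G H (\<Union> (range (D_set G H X))) \<and>
    is_tense_filter_generated_by G H X (\<Union> (range (D_set G H X)))"
proof -
  interpret tDL_algebra G H F P
    by (fact assms(1))
  have "\<Union> (range (D_set G H X)) \<subseteq> S" if "tense_filter G H S" "X \<subseteq> S" for S
    using D_set_subset_tense_filter[OF that] by blast
  then show ?thesis
    unfolding is_tense_filter_generated_by_def
    by (simp add: lattice_filter_D_set mono_D_set tense_filter_Union_D_set subset_Union_D_set
        assms(2))
qed

end
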